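(* Let $m\ge 2$ be an integer and let $u$ be a real function which is $m$ times continuously differentiable in a neighbourhood $D\subset\mathbb{R}$ of an isolated fixed point $x^*$ of $u$, with $$u(x^* )=x^*,\qquad u'(x^* )=1,\qquad u^{(j)}(x^* )=0\ \text{ for } 2\le j\le m-1,\qquad u^{(m)}(x^* )\neq 0 .$$ Define, near $x^*$, $$v(x)=\begin{cases}\dfrac{u(x)-x\,u'(x)}{1-u'(x)}, & x\neq x^*,\\[2mm] x^*, & x=x^*,\end{cases}\qquad\qquad w(x)=\frac{v(x)-x\,v'(x)}{1-v'(x)} .$$ Then $u$ belongs to the kernel of $w$ if and only if there are constants $\alpha$ and $\beta$ with $\beta\neq 0$ such that $$u(x)=x+\alpha\,(x^*-x)^{\beta}$$ for $x$ in a neighbourhood of $x^*$.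
   Context: The function $u$ is said to belong to the kernel of $w$ (where $w$ is built from $u$ as in the statement) if $w$ is the constant function $w(x)=x^*$ for all $x$ in a neighbourhood of $x^*$. *)

theory Defs
  imports "HOL-Analysis.Analysis"
begin

definition C_times_differentiable_on :: "nat \<Rightarrow> (real \<Rightarrow> real) \<Rightarrow> real set \<Rightarrow> bool" where
  "C_times_differentiable_on k f D \<longleftrightarrow>
     (\<forall>j<k. \<forall>x\<in>D. ((deriv ^^ j) f) field_differentiable (at x)) \<and>
     continuous_on D ((deriv ^^ k) f)"

text \<open>
  Abscissa of the intersection of the tangent to the graph of \<open>f\<close> at \<open>x\<close> with the diagonal.
  For \<open>f = u\<close> and \<open>f = v\<close> as below, the denominator is nonzero for all \<open>x \<noteq> xs\<close> close to
  the fixed point \<open>xs\<close> (for \<open>f = v\<close> also at \<open>xs\<close>); so the convention \<open>a / 0 = 0\<close> plays no role.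
\<close>
definition tangent_step :: "(real \<Rightarrow> real) \<Rightarrow> real \<Rightarrow> real" where
  "tangent_step f x = (f x - x * deriv f x) / (1 - deriv f x)"

definition v_fun :: "(real \<Rightarrow> real) \<Rightarrow> real \<Rightarrow> real \<Rightarrow> real" where
  "v_fun u xs x = (if x = xs then xs else tangent_step u x)"

definition w_fun :: "(real \<Rightarrow> real) \<Rightarrow> real \<Rightarrow> real \<Rightarrow> real" where
  "w_fun u xs x = tangent_step (v_fun u xs) x"

definition in_kernel :: "(real \<Rightarrow> real) \<Rightarrow> real \<Rightarrow> bool" where
  "in_kernel u xs \<longleftrightarrow> (\<forall>\<^sub>F x in nhds xs. w_fun u xs x = xs)"

text \<open>
  The base \<open>xs - x\<close> is negative to the right of \<open>xs\<close>, where real \<open>powr\<close> is not the power: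
  there \<open>t powr b\<close> equals \<open>\<bar>t\<bar> powr b\<close>, also for odd integers \<open>b\<close>. The equation for
  \<open>u\<close> is therefore stated between complex numbers, with the principal power: it agrees with
  real \<open>powr\<close> for \<open>xs - x > 0\<close> and with the ordinary power for integer exponents
  and \<open>xs - x \<noteq> 0\<close>. At \<open>x = xs\<close> it has the value 0.
\<close>
definition has_power_form :: "(real \<Rightarrow> real) \<Rightarrow> real \<Rightarrow> real \<Rightarrow> real \<Rightarrow> bool" where
  "has_power_form u xs \<alpha> \<beta> \<longleftrightarrow>
     (\<forall>\<^sub>F x in nhds xs.
        complex_of_real (u x) =
          complex_of_real x + complex_of_real \<alpha> * complex_of_real (xs - x) powr complex_of_real \<beta>)"

end

theory Submission
  imports Defs
begin

text \<open>
  Put \<open>d x = u x - x\<close> and \<open>y = x - x\<^sup>*\<close>. Then \<open>v x = x - g x\<close> with \<open>g = d / d'\<close>, and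
  \<open>w x = x\<^sup>*\<close> says that \<open>y g' = g\<close>. Since \<open>g / y\<close> tends to \<open>1 / m\<close>, this forces \<open>g = y / m\<close> on both
  sides of \<open>x\<^sup>*\<close>, that is \<open>y d' = m d\<close>; as \<open>d / y\<^sup>m\<close> has a limit at \<open>x\<^sup>*\<close>, \<open>d\<close> is the same multiple
  of \<open>y\<^sup>m\<close> on both sides. Conversely, for a power form with exponent \<open>\<beta>\<close> the quotient \<open>g / y\<close> equals
  \<open>1 / \<beta>\<close> to the left of \<open>x\<^sup>*\<close>, so \<open>\<beta> = m\<close>, and then \<open>g = y / m\<close> on both sides.
\<close>

text \<open>Induction on \<open>n\<close> with l'Hopital's rule: the induction hypothesis for the
  shifted family \<open>F (Suc j)\<close> gives the limit of the quotient of derivatives. For a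
  chain \<open>F\<close> of successive derivatives, the limit is the leading Taylor coefficient at
  \<open>a\<close>.\<close>

lemma peano_limit:
  fixes F :: "nat \<Rightarrow> real \<Rightarrow> real"
  assumes "open D" "a \<in> D"
    and "\<And>j x. j < n \<Longrightarrow> x \<in> D \<Longrightarrow> (F j has_real_derivative F (Suc j) x) (at x)"
    and "isCont (F n) a"
    and "\<And>j. j < n \<Longrightarrow> F j a = 0"
  shows "((\<lambda>x. F 0 x / (x - a) ^ n) \<longlongrightarrow> F n a / fact n) (at a)"
  using assms(3-5)
proof (induction n arbitrary: F)
  case 0
  then show ?case by (simp add: isCont_def)
next
  case (Suc n)
  have IH: "((\<lambda>x. F 1 x / (x - a) ^ n) \<longlongrightarrow> F (Suc n) a / fact n) (at a)"
    using Suc.IH[of "\<lambda>j. F (Suc j)"] Suc.prems by simp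
  have ev: "\<forall>\<^sub>F x in at a. x \<in> D \<and> x \<noteq> a"
    using eventually_at_topological assms(1,2) by blast
  have "isCont (F 0) a"
    using Suc.prems(1)[of 0 a] assms(2) DERIV_isCont by blast
  then have lim0: "F 0 \<midarrow>a\<rightarrow> 0"
    using Suc.prems(3)[of 0] by (simp add: isCont_def)
  have lim1: "((\<lambda>x. (x - a) ^ Suc n) \<longlongrightarrow> 0) (at a)"
    by (auto intro!: tendsto_eq_intros)
  have "((\<lambda>x. (F 1 x / (x - a) ^ n) / real (Suc n)) \<longlongrightarrow> (F (Suc n) a / fact n) / real (Suc n)) (at a)"
    by (intro tendsto_divide IH tendsto_const) simp
  then have lim2: "((\<lambda>x. F 1 x / (real (Suc n) * (x - a) ^ n)) \<longlongrightarrow> F (Suc n) a / fact (Suc n)) (at a)"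
    by (simp add: mult.commute)
  show ?case
  proof (rule lhopital[OF lim0 lim1 _ _ _ _ lim2])
    show "\<forall>\<^sub>F x in at a. (x - a) ^ Suc n \<noteq> 0"
      using ev by eventually_elim simp
    show "\<forall>\<^sub>F x in at a. real (Suc n) * (x - a) ^ n \<noteq> 0"
      using ev by eventually_elim simp
    show "\<forall>\<^sub>F x in at a. (F 0 has_real_derivative F 1 x) (at x)"
      using ev by eventually_elim (use Suc.prems(1)[of 0] in auto)
    show "\<forall>\<^sub>F x in at a. ((\<lambda>x. (x - a) ^ Suc n) has_real_derivative real (Suc n) * (x - a) ^ n) (at x)"
      using DERIV_power_Suc[OF DERIV_diff[OF DERIV_ident DERIV_const[of a]], of n]
      by (simp del: power_Suc)
  qed
qed

text \<open>The quotient \<open>h x / (x - a) ^ n\<close> has derivative zero off \<open>a\<close>,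
  so it is constant on each side; the two-sided limit \<open>L\<close> forces both constants to
  agree. It serves twice: for \<open>d / d1\<close> with exponent 1 and for \<open>d\<close> with
  exponent \<open>m\<close>.\<close>

lemma euler_ode_power:
  fixes h h' :: "real \<Rightarrow> real"
  assumes der: "\<forall>\<^sub>F x in at a. (h has_real_derivative h' x) (at x)"
    and ode: "\<forall>\<^sub>F x in at a. h' x * (x - a) = real n * h x"
    and lim: "((\<lambda>x. h x / (x - a) ^ n) \<longlongrightarrow> L) (at a)"
  shows "\<forall>\<^sub>F x in at a. h x = L * (x - a) ^ n"
proof -
  define q where "q = (\<lambda>x. h x / (x - a) ^ n)"
  from eventually_conj[OF der ode] obtain e where e: "e > 0"
    and der': "\<And>x. x \<noteq> a \<Longrightarrow> dist x a < e \<Longrightarrow> (h has_real_derivative h' x) (at x)"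
    and ode': "\<And>x. x \<noteq> a \<Longrightarrow> dist x a < e \<Longrightarrow> h' x * (x - a) = real n * h x"
    unfolding eventually_at by auto
  have dq: "(q has_real_derivative 0) (at x)" if x: "x \<noteq> a" "dist x a < e" for x
  proof -
    \<comment> \<open>The numerator in the quotient rule for \<open>q\<close>. The case
      \<open>n = 0\<close> is separate because \<open>n - 1\<close> is truncated; there the equation
      gives \<open>h' x = 0\<close>.\<close>
    have "h' x * (x - a) ^ n - h x * (real n * (x - a) ^ (n - 1)) = 0"
    proof (cases n)
      case (Suc k)
      have "h' x * (x - a) ^ n - h x * (real n * (x - a) ^ (n - 1))
        = (h' x * (x - a) - real n * h x) * (x - a) ^ k"
        by (simp add: Suc algebra_simps)
      then show ?thesis using ode'[OF x] by simp
    qed (use ode'[OF x] x in simp)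
    then show ?thesis
      unfolding q_def using x(1)
      by (auto intro!: derivative_eq_intros der'[OF x])
  qed
  \<comment> \<open>A one-sided interval \<open>S\<close> accumulates at \<open>a\<close>, so the
    constant value of \<open>q\<close> on it must be the limit \<open>L\<close>.\<close>
  have const: "q x = L" if S: "convex S" "a islimpt S" "x \<in> S"
    "\<And>t. t \<in> S \<Longrightarrow> t \<noteq> a \<and> dist t a < e" for S x
  proof -
    obtain c where c: "\<And>t. t \<in> S \<Longrightarrow> q t = c"
      using has_field_derivative_zero_constant[OF S(1), of q] dq S(4)
      by (metis has_field_derivative_at_within)
    have "(q \<longlongrightarrow> L) (at a within S)"
      using lim unfolding q_def by (rule tendsto_within_subset) simp
    moreover have "(q \<longlongrightarrow> c) (at a within S)"
      by (rule tendsto_eventually) (auto simp: eventually_at_filter c)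
    ultimately have "L = c"
      using S(2) tendsto_unique trivial_limit_within by blast
    then show ?thesis using c S(3) by simp
  qed
  have "q x = L" if x: "x \<noteq> a" "dist x a < e" for x
  proof (cases "x > a")
    case True
    show ?thesis
      by (rule const[of "{a<..<a + e}"])
        (use True x e in \<open>auto simp: dist_real_def islimpt_greaterThanLessThan1\<close>)
  next
    case False
    show ?thesis
      by (rule const[of "{a - e<..<a}"])
        (use False x e in \<open>auto simp: dist_real_def islimpt_greaterThanLessThan2\<close>)
  qed
  then show ?thesis
    unfolding eventually_at q_def using e by (force simp: field_simps)
qed

lemma tangent_step_eq_iff:
  "deriv f x \<noteq> 1 \<Longrightarrow> tangent_step f x = z \<longleftrightarrow> f x - x = (z - x) * (1 - deriv f x)"
  by (auto simp: tangent_step_def divide_eq_eq algebra_simps)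

text \<open>The tangent step of \<open>f\<close> is Newton's step for a zero of
  \<open>f x - x\<close>.\<close>

lemma tangent_step_conv:
  "deriv f x \<noteq> 1 \<Longrightarrow> tangent_step f x = x - (f x - x) / (deriv f x - 1)"
  by (simp add: tangent_step_def field_simps)

text \<open>For natural exponents the principal power is the ordinary one, also for negative base.
  Positivity of \<open>n\<close> matters at \<open>x = a\<close>, where \<open>powr\<close> gives 0
  but \<open>0 ^ 0\<close> is 1.\<close>

lemma has_power_form_nat_iff:
  assumes "0 < n"
  shows "has_power_form u a \<alpha> (real n) \<longleftrightarrow>
    (\<forall>\<^sub>F x in nhds a. u x = x + \<alpha> * (a - x) ^ n)"
proof -
  have "complex_of_real (a - x) powr complex_of_real (real n) = complex_of_real ((a - x) ^ n)" for x
    using assms by (cases "x = a") (auto simp: powr_nat' simp flip: of_real_power of_real_diff)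
  then have "(complex_of_real (u x) =
      complex_of_real x + complex_of_real \<alpha> * complex_of_real (a - x) powr complex_of_real (real n))
    \<longleftrightarrow> u x = x + \<alpha> * (a - x) ^ n" for x
    by (metis of_real_add of_real_eq_iff of_real_mult)
  then show ?thesis
    unfolding has_power_form_def by presburger
qed

text \<open>Derivatives are local, and a neighbourhood of \<open>a\<close> cut with the open set
  \<open>S\<close> and punctured at \<open>a\<close> is open. Used for the left side of
  \<open>a\<close> and for both sides.\<close>

lemma eventually_derivative_unique:
  fixes f g :: "real \<Rightarrow> real"
  assumes "open S"
    and eq: "\<forall>\<^sub>F x in at a within S. f x = g x"
    and f: "\<forall>\<^sub>F x in at a within S. (f has_real_derivative f' x) (at x)"
    and g: "\<forall>\<^sub>F x in at a within S. (g has_real_derivative g' x) (at x)"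
  shows "\<forall>\<^sub>F x in at a within S. f' x = g' x"
proof -
  obtain T where T: "open T" "a \<in> T" "\<And>x. x \<in> T \<Longrightarrow> x \<noteq> a \<Longrightarrow> x \<in> S \<Longrightarrow> f x = g x"
    using eq unfolding eventually_at_topological by auto
  have "\<forall>\<^sub>F x in at a within S. x \<in> T \<inter> S - {a}"
    unfolding eventually_at_topological using T by blast
  then show ?thesis
    using f g
  proof eventually_elim
    case (elim x)
    have "(g has_real_derivative f' x) (at x)"
      by (rule has_field_derivative_transform_within_open[OF elim(2), of "T \<inter> S - {a}"])
        (use T elim assms(1) in \<open>auto intro: open_Diff\<close>)
    then show ?case
      using elim(3) DERIV_unique by blast
  qed
qed

theorem proposition6:
  fixes u :: "real \<Rightarrow> real" and xs :: real and D :: "real set" and m :: nat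
  assumes "m \<ge> 2"
    and "open D" and "xs \<in> D"
    and "C_times_differentiable_on m u D"
    and "xs isolated_in {x \<in> D. u x = x}"
    and "u xs = xs"
    and "deriv u xs = 1"
    and "\<And>j. 2 \<le> j \<Longrightarrow> j \<le> m - 1 \<Longrightarrow> (deriv ^^ j) u xs = 0"
    and "(deriv ^^ m) u xs \<noteq> 0"
  shows "in_kernel u xs \<longleftrightarrow> (\<exists>\<alpha> \<beta> :: real. \<beta> \<noteq> 0 \<and> has_power_form u xs \<alpha> \<beta>)"
proof -

  \<comment> \<open>Taylor asymptotics of \<open>u x - x\<close>\<close>
  obtain n where m: "m = Suc (Suc n)"
    using le_Suc_ex[OF assms(1)] by auto
  define c where "c = (deriv ^^ m) u xs"
  have c: "c \<noteq> 0" using assms(9) by (simp add: c_def)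
  \<comment> \<open>\<open>F j\<close> is the \<open>j\<close>-th derivative of
    \<open>u x - x\<close>. All of them below order \<open>m\<close> vanish at \<open>xs\<close>,
    and \<open>F m\<close> agrees with the \<open>m\<close>-th derivative of \<open>u\<close>
    because \<open>m\<close> is at least 2.\<close>
  define F where "F = (\<lambda>j x. (deriv ^^ j) u x - (if j = 0 then x else if j = 1 then 1 else 0))"
  define d where "d = F 0"
  define d1 where "d1 = F 1"
  define d2 where "d2 = F 2"
  define v where "v = v_fun u xs"
  \<comment> \<open>The derivative of the Newton map \<open>x - d x / d1 x\<close>; thus
    \<open>1 - r\<close> is the derivative of \<open>d / d1\<close>.\<close>
  define r where "r = (\<lambda>x. d x * d2 x / (d1 x)\<^sup>2)"
  have d_eq: "d x = u x - x" and d1_eq: "d1 x = deriv u x - 1" for x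
    by (simp_all add: d_def d1_def F_def)
  have F_der: "(F j has_real_derivative F (Suc j) x) (at x)" if "j < m" "x \<in> D" for j x
  proof -
    have "((deriv ^^ j) u has_real_derivative (deriv ^^ Suc j) u x) (at x)"
      using assms(4) that DERIV_deriv_iff_field_differentiable
      unfolding C_times_differentiable_on_def by auto
    then show ?thesis
      unfolding F_def by (cases "j = 0"; cases "j = 1") (auto intro!: derivative_eq_intros)
  qed
  have F_cont: "isCont (F m) xs"
    using assms(2-4) continuous_on_eq_continuous_at
    unfolding F_def C_times_differentiable_on_def m by auto
  have F_0: "F j xs = 0" if "j < m" for j
    using assms(6,7) assms(8)[of j] that unfolding F_def
    by (cases "j = 0"; cases "j = 1") auto
  have F_m: "F m xs = c"
    by (simp add: F_def c_def m)
  have F_lim: "((\<lambda>x. F k x / (x - xs) ^ (m - k)) \<longlongrightarrow> c / fact (m - k)) (at xs)" if "k \<le> m" for k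
    using peano_limit[OF assms(2,3), of "m - k" "\<lambda>j. F (j + k)"] that F_der F_cont F_0 F_m
    by simp
  have lim: "((\<lambda>x. d x / (x - xs) ^ m) \<longlongrightarrow> c / fact m) (at xs)"
    and lim1: "((\<lambda>x. d1 x / (x - xs) ^ Suc n) \<longlongrightarrow> c / fact (Suc n)) (at xs)"
    and lim2: "((\<lambda>x. d2 x / (x - xs) ^ n) \<longlongrightarrow> c / fact n) (at xs)"
    using F_lim[of 0] F_lim[of 1] F_lim[of 2] by (simp_all add: d_def d1_def d2_def m numeral_2_eq_2)
  have ev: "\<forall>\<^sub>F x in at xs. x \<in> D \<and> x \<noteq> xs"
    using eventually_at_topological assms(2,3) by blast
  have d_der: "\<forall>\<^sub>F x in at xs. (d has_real_derivative d1 x) (at x)"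
    using ev by eventually_elim (use F_der[of 0] in \<open>auto simp: d_def d1_def m\<close>)
  have d_nz: "\<forall>\<^sub>F x in at xs. d x \<noteq> 0"
    using tendsto_imp_eventually_ne[OF lim, of 0] c by (auto elim: eventually_mono)
  have d1_nz: "\<forall>\<^sub>F x in at xs. d1 x \<noteq> 0"
    using tendsto_imp_eventually_ne[OF lim1, of 0] c by (auto elim: eventually_mono)

  \<comment> \<open>Limits of the Newton correction and of \<open>r\<close>\<close>
  have q_lim: "((\<lambda>x. d x / d1 x / (x - xs)) \<longlongrightarrow> 1 / real m) (at xs)"
  proof (rule Lim_transform_eventually)
    show "((\<lambda>x. (d x / (x - xs) ^ m) / (d1 x / (x - xs) ^ Suc n)) \<longlongrightarrow> 1 / real m) (at xs)"
      by (rule tendsto_eq_intros lim lim1)+ (use c in \<open>auto simp: m\<close>)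
    show "\<forall>\<^sub>F x in at xs. (d x / (x - xs) ^ m) / (d1 x / (x - xs) ^ Suc n) = d x / d1 x / (x - xs)"
      using ev d1_nz by eventually_elim (simp add: m)
  qed
  have r_lim: "(r \<longlongrightarrow> 1 - 1 / real m) (at xs)"
  proof (rule Lim_transform_eventually)
    \<comment> \<open>With \<open>n = m - 2\<close> the factorials reduce to
      \<open>(m - 1) / m\<close>.\<close>
    have val: "c / fact m * (c / fact n) / (c / fact (Suc n))\<^sup>2 = 1 - 1 / real m"
      using c by (simp add: m power2_eq_square divide_simps)
    show "((\<lambda>x. (d x / (x - xs) ^ m) * (d2 x / (x - xs) ^ n) / (d1 x / (x - xs) ^ Suc n)\<^sup>2)
        \<longlongrightarrow> 1 - 1 / real m) (at xs)"
      unfolding val[symmetric]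
      by (intro tendsto_divide tendsto_mult tendsto_power lim lim1 lim2) (use c in simp)
    show "\<forall>\<^sub>F x in at xs. (d x / (x - xs) ^ m) * (d2 x / (x - xs) ^ n) / (d1 x / (x - xs) ^ Suc n)\<^sup>2
        = r x"
      using ev
    proof eventually_elim
      case (elim x)
      have "a / (y * (y * p)) * (b / p) / (e / (y * p))\<^sup>2 = a * b / e\<^sup>2"
        if "y \<noteq> 0" "p \<noteq> 0" for a b e y p :: real
        using that by (simp add: power2_eq_square)
      then show ?case
        using elim by (simp add: m r_def)
    qed
  qed
  \<comment> \<open>This keeps the denominator of \<open>w_fun\<close> away from zero near
    \<open>xs\<close>.\<close>
  have r_ne: "\<forall>\<^sub>F x in at xs. r x \<noteq> 1"
    by (rule tendsto_imp_eventually_ne[OF r_lim]) (simp add: m)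
  have g_der: "\<forall>\<^sub>F x in at xs. ((\<lambda>x. d x / d1 x) has_real_derivative 1 - r x) (at x)"
    using ev d1_nz
  proof eventually_elim
    case (elim x)
    have "(d has_real_derivative d1 x) (at x)" "(d1 has_real_derivative d2 x) (at x)"
      using F_der[of 0 x] F_der[of 1 x] elim by (simp_all add: d_def d1_def d2_def m numeral_2_eq_2)
    then show ?case
      by (auto intro!: derivative_eq_intros simp: elim r_def field_simps power2_eq_square)
  qed

  \<comment> \<open>The derivative of \<open>v\<close>, off and at the fixed point\<close>
  have v_eq: "\<forall>\<^sub>F x in at xs. v x = x - d x / d1 x"
    using ev d1_nz
    by eventually_elim (auto simp: v_def v_fun_def tangent_step_conv d_eq d1_eq)
  have v_xs: "v xs = xs"
    by (simp add: v_def v_fun_def)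
  have v_der: "\<forall>\<^sub>F x in at xs. deriv v x = r x"
  proof -
    obtain T where T: "open T" "xs \<in> T" "\<And>x. x \<in> T \<Longrightarrow> x \<noteq> xs \<Longrightarrow> v x = x - d x / d1 x"
      using v_eq unfolding eventually_at_topological by auto
    have "\<forall>\<^sub>F x in at xs. x \<in> T - {xs}"
      unfolding eventually_at_topological using T by blast
    then show ?thesis
      using g_der
    proof eventually_elim
      case (elim x)
      have "((\<lambda>x. x - d x / d1 x) has_real_derivative r x) (at x)"
        using DERIV_diff[OF DERIV_ident elim(2)] by simp
      then have "(v has_real_derivative r x) (at x)"
        by (rule has_field_derivative_transform_within_open[of _ _ _ "T - {xs}"])
          (use T elim in auto)
      then show ?case by (rule DERIV_imp_deriv)
    qed
  qed
  \<comment> \<open>At \<open>xs\<close> the value of \<open>v\<close> is prescribed separately, so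
    the difference quotient is used. Since the derivative is not 1,
    \<open>w_fun u xs xs = xs\<close> holds outright, and the kernel condition concerns only points
    other than \<open>xs\<close>.\<close>
  have "(v has_real_derivative 1 - 1 / real m) (at xs)"
    unfolding has_field_derivative_iff
  proof (rule Lim_transform_eventually)
    show "((\<lambda>x. 1 - d x / d1 x / (x - xs)) \<longlongrightarrow> 1 - 1 / real m) (at xs)"
      by (intro tendsto_intros q_lim)
    show "\<forall>\<^sub>F x in at xs. 1 - d x / d1 x / (x - xs) = (v x - v xs) / (x - xs)"
      using ev v_eq
    proof eventually_elim
      case (elim x)
      have "v x - v xs = (x - xs) - d x / d1 x"
        using elim by (simp add: v_xs)
      then show ?case
        using elim(1) by (simp add: diff_divide_distrib[of "x - xs"])
    qed
  qed
  then have "deriv v xs = 1 - 1 / real m"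
    by (rule DERIV_imp_deriv)
  then have w_xs: "w_fun u xs xs = xs"
    unfolding w_fun_def v_def[symmetric]
    by (subst tangent_step_eq_iff) (simp_all add: m v_xs)
  \<comment> \<open>The factor \<open>real 1\<close> gives the equation the shape that
    \<open>euler_ode_power\<close> expects for exponent 1.\<close>
  have "\<forall>\<^sub>F x in at xs. w_fun u xs x = xs \<longleftrightarrow> (1 - r x) * (x - xs) = real 1 * (d x / d1 x)"
    using v_der r_ne v_eq
  proof eventually_elim
    case (elim x)
    have "w_fun u xs x = xs \<longleftrightarrow> v x - x = (xs - x) * (1 - r x)"
      unfolding w_fun_def v_def[symmetric]
      using elim by (subst tangent_step_eq_iff) auto
    then show ?case
      using elim(3) by (auto simp: algebra_simps)
  qed
  then have kernel_iff: "in_kernel u xs \<longleftrightarrow>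
      (\<forall>\<^sub>F x in at xs. (1 - r x) * (x - xs) = real 1 * (d x / d1 x))"
    unfolding in_kernel_def eventually_nhds_conv_at using w_xs eventually_subst by force
  show ?thesis
  proof

    \<comment> \<open>From the kernel to a power form\<close>
    assume "in_kernel u xs"
    then have ode: "\<forall>\<^sub>F x in at xs. (1 - r x) * (x - xs) = real 1 * (d x / d1 x)"
      by (simp only: kernel_iff)
    have "\<forall>\<^sub>F x in at xs. d x / d1 x = 1 / real m * (x - xs) ^ 1"
      by (rule euler_ode_power[OF g_der ode]) (use q_lim in simp)
    then have ode': "\<forall>\<^sub>F x in at xs. d1 x * (x - xs) = real m * d x"
      using d1_nz by eventually_elim (simp add: field_simps m)
    have "\<forall>\<^sub>F x in at xs. d x = c / fact m * (x - xs) ^ m"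
      using d_der ode' lim by (rule euler_ode_power)
    then have "\<forall>\<^sub>F x in nhds xs. d x = c / fact m * (x - xs) ^ m"
      by (simp add: eventually_nhds_conv_at d_eq assms(6) m)
    \<comment> \<open>The sign \<open>(-1) ^ m\<close> comes from passing from \<open>x - xs\<close>
      to \<open>xs - x\<close>.\<close>
    then have "\<forall>\<^sub>F x in nhds xs. u x = x + (c / fact m * (-1) ^ m) * (xs - x) ^ m"
    proof eventually_elim
      case (elim x)
      have "(xs - x) ^ m = (-1) ^ m * (x - xs) ^ m"
        by (simp flip: power_mult_distrib)
      then show ?case
        using elim by (simp add: d_eq algebra_simps flip: power_mult_distrib)
    qed
    then have "has_power_form u xs (c / fact m * (-1) ^ m) (real m)"
      using has_power_form_nat_iff[of m] m by blast
    then show "\<exists>\<alpha> \<beta> :: real. \<beta> \<noteq> 0 \<and> has_power_form u xs \<alpha> \<beta>"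
      using m by (metis of_nat_eq_0_iff Zero_not_Suc)
  next

    \<comment> \<open>From a power form to the kernel\<close>
    assume "\<exists>\<alpha> \<beta> :: real. \<beta> \<noteq> 0 \<and> has_power_form u xs \<alpha> \<beta>"
    then obtain \<alpha> \<beta> where \<beta>: "\<beta> \<noteq> 0" and form: "has_power_form u xs \<alpha> \<beta>"
      by blast
    \<comment> \<open>To the left of \<open>xs\<close> the base \<open>xs - x\<close> is positive,
      so the principal power is the real \<open>powr\<close> and can be differentiated for any real
      \<open>\<beta>\<close>. The exponent is identified there first.\<close>
    have left: "\<forall>\<^sub>F x in at_left xs. P x" if "\<forall>\<^sub>F x in at xs. P x" for P
      using that by (simp add: eventually_at_split)
    have less: "\<forall>\<^sub>F x in at_left xs. x < xs"
      by (simp add: eventually_at_filter)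
    have "\<forall>\<^sub>F x in at_left xs. complex_of_real (u x) =
          complex_of_real x + complex_of_real \<alpha> * complex_of_real (xs - x) powr complex_of_real \<beta>"
      using form unfolding has_power_form_def eventually_nhds_conv_at by (blast intro: left)
    then have d_left: "\<forall>\<^sub>F x in at_left xs. d x = \<alpha> * (xs - x) powr \<beta>"
      using less
    proof eventually_elim
      case (elim x)
      have "complex_of_real (xs - x) powr complex_of_real \<beta> = complex_of_real ((xs - x) powr \<beta>)"
        using elim(2) by (intro powr_of_real) auto
      then have "complex_of_real (u x) = complex_of_real (x + \<alpha> * (xs - x) powr \<beta>)"
        using elim(1) by simp
      then show ?case
        unfolding of_real_eq_iff d_eq by simp
    qed
    have "\<forall>\<^sub>F x in at_left xs. ((\<lambda>x. \<alpha> * (xs - x) powr \<beta>) has_real_derivative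
        - \<alpha> * \<beta> * (xs - x) powr (\<beta> - 1)) (at x)"
      using less by eventually_elim (auto intro!: derivative_eq_intros)
    then have "\<forall>\<^sub>F x in at_left xs. d1 x = - \<alpha> * \<beta> * (xs - x) powr (\<beta> - 1)"
      by (rule eventually_derivative_unique[OF _ d_left left[OF d_der], rotated]) simp
    \<comment> \<open>That \<open>d x\<close> is nonzero near \<open>xs\<close> permits the division
      and takes the place of a separate proof that \<open>\<alpha>\<close> is nonzero.\<close>
    then have "\<forall>\<^sub>F x in at_left xs. d x / d1 x / (x - xs) = 1 / \<beta>"
      using d_left left[OF d_nz] less
    proof eventually_elim
      case (elim x)
      have "(xs - x) powr (\<beta> - 1) * (xs - x) = (xs - x) powr \<beta>"
        using elim(4) by (simp add: powr_diff)
      moreover have "d1 x * (x - xs) = \<alpha> * \<beta> * ((xs - x) powr (\<beta> - 1) * (xs - x))"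
        unfolding elim(1) by (simp add: algebra_simps)
      ultimately have "d1 x * (x - xs) = \<beta> * d x"
        using elim(2) by simp
      then show ?case
        using elim(3) \<beta> by simp
    qed
    then have "((\<lambda>x. d x / d1 x / (x - xs)) \<longlongrightarrow> 1 / \<beta>) (at_left xs)"
      by (rule tendsto_eventually)
    moreover have "((\<lambda>x. d x / d1 x / (x - xs)) \<longlongrightarrow> 1 / real m) (at_left xs)"
      using q_lim by (rule tendsto_within_subset) simp
    ultimately have "1 / \<beta> = 1 / real m"
      using tendsto_unique trivial_limit_at_left_real by blast
    then have "\<beta> = real m"
      using \<beta> by (simp add: m field_simps)
    \<comment> \<open>Now that the exponent is natural, the formula is real-valued on both sides of
      \<open>xs\<close>.\<close>
    then have "\<forall>\<^sub>F x in nhds xs. u x = x + \<alpha> * (xs - x) ^ m"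
      using form has_power_form_nat_iff[of m] m by blast
    then have d_pow: "\<forall>\<^sub>F x in at xs. d x = \<alpha> * (xs - x) ^ m"
      unfolding eventually_nhds_conv_at by (auto simp: d_eq elim: eventually_mono)
    have "\<forall>\<^sub>F x in at xs. ((\<lambda>x. \<alpha> * (xs - x) ^ m) has_real_derivative
        - \<alpha> * real m * (xs - x) ^ Suc n) (at x)"
      by (rule always_eventually) (auto intro!: derivative_eq_intros simp: m simp del: power_Suc of_nat_Suc)
    then have "\<forall>\<^sub>F x in at xs. d1 x = - \<alpha> * real m * (xs - x) ^ Suc n"
      by (rule eventually_derivative_unique[OF _ d_pow d_der, rotated]) simp
    then have g_lin: "\<forall>\<^sub>F x in at xs. d x / d1 x = (x - xs) / real m"
      using d_pow d1_nz
    proof eventually_elim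
      case (elim x)
      have "d1 x * (x - xs) = real m * d x"
        unfolding elim(1,2) by (simp add: m algebra_simps)
      then show ?case
        using elim(3) by (simp add: m field_simps)
    qed
    have "\<forall>\<^sub>F x in at xs. ((\<lambda>x. (x - xs) / real m) has_real_derivative 1 / real m) (at x)"
      by (rule always_eventually) (auto intro!: derivative_eq_intros simp: m)
    then have "\<forall>\<^sub>F x in at xs. 1 - r x = 1 / real m"
      by (rule eventually_derivative_unique[OF _ g_lin g_der, rotated]) simp
    then show "in_kernel u xs"
      unfolding kernel_iff using g_lin by eventually_elim simp
  qed
qed

end
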